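(* Let $c\ge 2$ be an integer. Let $G$ be an orderable group and let $S$ be a finite subset of $G$ such that $\langle S\rangle$ is abelian. If $$|S^2|<(c+1)|S|-\frac{c(c+1)}{2},$$ then $\langle S\rangle$ is generated by a set of at most $c$ elements.
   Context: A group $G$ is orderable if there is a total order $\le$ on $G$ such that $a\le b$ implies $xay\le xby$ for all $a,b,x,y\in G$. For a subset $S$ of a group, $S^2=\{x_1x_2 : x_1,x_2\in S\}$, and $\langle S\rangle$ is the subgroup generated by $S$. *)

theory Defs
  imports Complex_Main "HOL-Algebra.Generated_Groups"
begin

definition orderable_group :: "('a, 'b) monoid_scheme \<Rightarrow> bool" where
  "orderable_group G \<longleftrightarrow> group G \<and>
     (\<exists>r. linear_order_on (carrier G) r \<and>
        (\<forall>a\<in>carrier G. \<forall>b\<in>carrier G. \<forall>x\<in>carrier G. \<forall>y\<in>carrier G.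
           (a, b) \<in> r \<longrightarrow> (x \<otimes>\<^bsub>G\<^esub> a \<otimes>\<^bsub>G\<^esub> y, x \<otimes>\<^bsub>G\<^esub> b \<otimes>\<^bsub>G\<^esub> y) \<in> r))"

end

theory Submission
  imports Defs
begin

text \<open>
  The proof works with the number of generators of the subgroup generated by the quotients
  \<open>x / y\<close> of elements of \<open>A\<close>, in place of the affine dimension of Freiman's lemma; no linear
  algebra is needed. Remove the greatest element \<open>v\<close> of \<open>A\<close>, leaving \<open>A'\<close>. If \<open>x \<in> A\<close> is such
  that \<open>v x = y z\<close> with \<open>y, z \<in> A'\<close>, then \<open>x / v = (y / v) (z / v)\<close> with \<open>y, z > x\<close>, so the
  quotient group is generated by the \<open>x / v\<close> for which \<open>v x\<close> is a new product, i.e. not in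
  \<open>A'\<^sup>2\<close>. Hence there are at least \<open>n + 1\<close> new products if fewer than \<open>n\<close> generators do not
  suffice. If moreover \<open>A'\<close> has a smaller quotient group than \<open>A\<close>, then all \<open>|A|\<close> products
  \<open>v x\<close> are new. Induction on \<open>|A|\<close> gives \<open>|A\<^sup>2| \<ge> (n + 1) |A| - n (n + 1) / 2\<close>.
\<close>

text \<open>Taking all pairs singles out no base point. This makes monotonicity in \<open>A\<close>
  immediate, even when the element removed from \<open>A\<close> would have been the base
  point.\<close>

definition quotient_group :: "('a, 'b) monoid_scheme \<Rightarrow> 'a set \<Rightarrow> 'a set" where
  "quotient_group G A = generate G {x \<otimes>\<^bsub>G\<^esub> inv\<^bsub>G\<^esub> y | x y. x \<in> A \<and> y \<in> A}"

text \<open>The strict bound makes the predicate false for \<open>n = 0\<close>, so that it can hold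
  only for a successor, and it leaves room for one further generator in the final theorem.\<close>

definition generated_by_fewer :: "('a, 'b) monoid_scheme \<Rightarrow> nat \<Rightarrow> 'a set \<Rightarrow> bool" where
  "generated_by_fewer G n H \<longleftrightarrow>
     (\<exists>T. T \<subseteq> carrier G \<and> finite T \<and> card T < n \<and> generate G T = H)"

section \<open>Quotient groups and their generators\<close>

context group
begin

lemma mult_inv_in_quotient_group:
  assumes "x \<in> A" "y \<in> A"
  shows "x \<otimes> inv y \<in> quotient_group G A"
  unfolding quotient_group_def using assms by (blast intro: generate.incl)

lemma subgroup_quotient_group:
  assumes "A \<subseteq> carrier G"
  shows "subgroup (quotient_group G A) G"
  unfolding quotient_group_def by (rule generate_is_subgroup) (use assms in auto)

lemma quotient_group_mono:
  assumes "A \<subseteq> B" "B \<subseteq> carrier G"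
  shows "quotient_group G A \<subseteq> quotient_group G B"
  unfolding quotient_group_def by (rule mono_generate) (use assms in auto)

text \<open>One base point suffices, because x / y = (x / v) (y / v)^(-1).\<close>

lemma quotient_group_subset:
  assumes H: "subgroup H G" and A: "A \<subseteq> carrier G" "v \<in> carrier G"
    and sub: "\<And>x. x \<in> A \<Longrightarrow> x \<otimes> inv v \<in> H"
  shows "quotient_group G A \<subseteq> H"
  unfolding quotient_group_def
proof (rule generate_subgroup_incl[OF _ H], safe)
  fix x y assume xy: "x \<in> A" "y \<in> A"
  then have c: "x \<in> carrier G" "y \<in> carrier G" using A by auto
  have "x \<otimes> inv y = (x \<otimes> inv v) \<otimes> inv (y \<otimes> inv v)"
    using c A(2) by (simp add: inv_mult_group m_assoc inv_solve_left)
  then show "x \<otimes> inv y \<in> H"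
    using sub[OF xy(1)] sub[OF xy(2)] H by (simp add: subgroup.m_closed subgroup.m_inv_closed)
qed

lemma generate_eq_quotient_group:
  assumes A: "A \<subseteq> carrier G" and v: "v \<in> A" and T: "T \<subseteq> quotient_group G A"
    and gen: "\<And>x. x \<in> A \<Longrightarrow> x \<otimes> inv v \<in> generate G T"
  shows "generate G T = quotient_group G A"
proof
  have Q: "subgroup (quotient_group G A) G" by (rule subgroup_quotient_group[OF A])
  show "generate G T \<subseteq> quotient_group G A" by (rule generate_subgroup_incl[OF T Q])
  have "T \<subseteq> carrier G" using T subgroup.subset[OF Q] by auto
  then show "quotient_group G A \<subseteq> generate G T"
    using quotient_group_subset[OF generate_is_subgroup A _ gen] A v by auto
qed

text \<open>Since x = (x / v) v, passing from the quotient group to the group generated by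
  \<open>A\<close> costs just one generator.\<close>

lemma generate_eq_insert_quotient_group:
  assumes A: "A \<subseteq> carrier G" and v: "v \<in> A" and T: "T \<subseteq> carrier G"
    and gen: "generate G T = quotient_group G A"
  shows "generate G (insert v T) = generate G A"
proof
  have sA: "subgroup (generate G A) G" by (rule generate_is_subgroup[OF A])
  have vc: "v \<in> carrier G" using A v by auto
  have incl: "x \<in> A \<Longrightarrow> x \<in> generate G A" for x by (rule generate.incl)
  have "quotient_group G A \<subseteq> generate G A"
    unfolding quotient_group_def
    by (rule generate_subgroup_incl[OF _ sA])
       (use incl in \<open>auto simp: subgroup.m_closed[OF sA] subgroup.m_inv_closed[OF sA]\<close>)
  then show "generate G (insert v T) \<subseteq> generate G A"
    using gen v incl by (intro generate_subgroup_incl[OF _ sA]) (auto intro: generate.incl)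
  have sT: "subgroup (generate G (insert v T)) G"
    by (rule generate_is_subgroup) (use T vc in auto)
  show "generate G A \<subseteq> generate G (insert v T)"
  proof (rule generate_subgroup_incl[OF _ sT], rule subsetI)
    fix x assume x: "x \<in> A"
    have "x \<otimes> inv v \<in> generate G (insert v T)"
      using mult_inv_in_quotient_group[OF x v] mono_generate[of T "insert v T"] gen by auto
    then have "(x \<otimes> inv v) \<otimes> v \<in> generate G (insert v T)"
      by (rule subgroup.m_closed[OF sT]) (simp add: generate.incl)
    then show "x \<in> generate G (insert v T)" using x A vc by (simp add: m_assoc subset_iff)
  qed
qed

lemma finite_set_mult:
  assumes "finite A" "finite B"
  shows "finite (A <#> B)"
  using assms by (auto simp: set_mult_def)

end

section \<open>Finite subsets of ordered abelian groups\<close>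

lemma linear_order_on_greatest:
  assumes "linear_order_on C r" "finite A" "A \<noteq> {}" "A \<subseteq> C"
  shows "\<exists>v\<in>A. \<forall>x\<in>A. (x, v) \<in> r"
  using assms(2-4)
proof (induction A rule: finite_ne_induct)
  case (singleton x)
  then show ?case using assms(1) by (auto simp: order_on_defs refl_on_def)
next
  case (insert a A)
  then obtain v where v: "v \<in> A" "\<forall>x\<in>A. (x, v) \<in> r" by auto
  have refl: "(a, a) \<in> r" "(v, v) \<in> r" and tr: "trans r" and tot: "total_on C r"
    using insert.prems v(1) assms(1) by (auto simp: order_on_defs refl_on_def)
  show ?case
  proof (cases "(a, v) \<in> r")
    case True
    then show ?thesis using v by auto
  next
    case False
    then have "(v, a) \<in> r"
      using tot refl insert.prems v(1) by (metis insert_subset subsetD total_on_def)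
    then show ?thesis using v refl tr by (auto dest: transD)
  qed
qed

text \<open>Monotonicity is stated on one side only because multiplication commutes.\<close>

locale ordered_comm_group = comm_group +
  fixes r
  assumes order: "linear_order_on (carrier G) r"
    and mono: "\<lbrakk>(a, b) \<in> r; a \<in> carrier G; b \<in> carrier G; x \<in> carrier G\<rbrakk>
                 \<Longrightarrow> (a \<otimes> x, b \<otimes> x) \<in> r"
begin

lemma order_trans: "(a, b) \<in> r \<Longrightarrow> (b, c) \<in> r \<Longrightarrow> (a, c) \<in> r"
  using order by (auto simp: order_on_defs dest: transD)

lemma order_antisym: "(a, b) \<in> r \<Longrightarrow> (b, a) \<in> r \<Longrightarrow> a = b"
  using order by (auto simp: order_on_defs dest: antisymD)

lemma order_refl: "a \<in> carrier G \<Longrightarrow> (a, a) \<in> r"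
  using order by (auto simp: order_on_defs refl_on_def)

text \<open>Multiply z < v by x / z: the left side becomes x, and the right side becomes v x / z =
  y.\<close>

lemma less_of_mult_eq:
  assumes c: "v \<in> carrier G" "x \<in> carrier G" "y \<in> carrier G" "z \<in> carrier G"
    and eq: "v \<otimes> x = y \<otimes> z" and z: "(z, v) \<in> r" "z \<noteq> v"
  shows "(x, y) \<in> r" "x \<noteq> y"
proof -
  have "(z \<otimes> (x \<otimes> inv z), v \<otimes> (x \<otimes> inv z)) \<in> r" using mono z c by simp
  moreover have "z \<otimes> (x \<otimes> inv z) = x"
    using c by (metis inv_closed m_assoc m_comm r_inv r_one)
  moreover have "v \<otimes> (x \<otimes> inv z) = y"
    using c eq by (metis inv_closed m_assoc r_inv r_one)
  ultimately show "(x, y) \<in> r" by simp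
  show "x \<noteq> y" using c eq z(2) by (metis m_comm right_cancel)
qed

text \<open>The induction runs downwards from the greatest element \<open>v\<close>. An old product
  v x = y z reduces x / v to y / v and z / v, where y and z are greater than x.\<close>

lemma quotients_from_new_products:
  assumes A: "A \<subseteq> carrier G" "finite A" and v: "v \<in> A" "\<And>x. x \<in> A \<Longrightarrow> (x, v) \<in> r"
    and H: "subgroup H G"
    and new: "\<And>x. \<lbrakk>x \<in> A; v \<otimes> x \<notin> (A - {v}) <#> (A - {v})\<rbrakk> \<Longrightarrow> x \<otimes> inv v \<in> H"
    and x: "x \<in> A"
  shows "x \<otimes> inv v \<in> H"
  using x
proof (induction "card {y \<in> A. (x, y) \<in> r}" arbitrary: x rule: less_induct)
  case less
  show ?case
  proof (cases "v \<otimes> x \<in> (A - {v}) <#> (A - {v})")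
    case False
    then show ?thesis using new less.prems by blast
  next
    case True
    then obtain y z where yz: "y \<in> A" "y \<noteq> v" "z \<in> A" "z \<noteq> v" "v \<otimes> x = y \<otimes> z"
      by (auto simp: set_mult_def)
    have c: "v \<in> carrier G" "x \<in> carrier G" "y \<in> carrier G" "z \<in> carrier G"
      using A v yz less.prems by auto
    have "v \<otimes> x = z \<otimes> y" using yz c m_comm by simp
    then have lt: "(x, y) \<in> r" "x \<noteq> y" "(x, z) \<in> r" "x \<noteq> z"
      using less_of_mult_eq[OF c] less_of_mult_eq[OF c(1,2,4,3)] v(2) yz by auto
    \<comment> \<open>The induction measure drops because x itself is not above any u > x.\<close>
    have "card {w \<in> A. (u, w) \<in> r} < card {w \<in> A. (x, w) \<in> r}"
      if u: "(x, u) \<in> r" "x \<noteq> u" for u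
    proof (rule psubset_card_mono)
      show "finite {w \<in> A. (x, w) \<in> r}" using A by simp
      have "{w \<in> A. (u, w) \<in> r} \<subseteq> {w \<in> A. (x, w) \<in> r}" using order_trans[OF u(1)] by blast
      moreover have "x \<in> {w \<in> A. (x, w) \<in> r}" using less.prems order_refl[OF c(2)] by simp
      moreover have "x \<notin> {w \<in> A. (u, w) \<in> r}" using order_antisym u by blast
      ultimately show "{w \<in> A. (u, w) \<in> r} \<subset> {w \<in> A. (x, w) \<in> r}" by blast
    qed
    then have "y \<otimes> inv v \<in> H" "z \<otimes> inv v \<in> H" using less.hyps lt yz by auto
    then have "(y \<otimes> inv v) \<otimes> (z \<otimes> inv v) \<in> H" by (rule subgroup.m_closed[OF H])
    moreover have "(y \<otimes> inv v) \<otimes> (z \<otimes> inv v) = (y \<otimes> z) \<otimes> inv v \<otimes> inv v"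
      using c by (simp add: m_ac)
    moreover have "\<dots> = x \<otimes> inv v"
      unfolding yz(5)[symmetric] using c by (simp add: m_comm[of v x] m_assoc)
    ultimately show ?thesis by simp
  qed
qed

lemma card_new_products:
  assumes A: "A \<subseteq> carrier G" "finite A" and v: "v \<in> A" "\<And>x. x \<in> A \<Longrightarrow> (x, v) \<in> r"
    and ngen: "\<not> generated_by_fewer G n (quotient_group G A)"
  shows "n < card {x \<in> A. v \<otimes> x \<notin> (A - {v}) <#> (A - {v})}"
proof -
  define N where "N = {x \<in> A. v \<otimes> x \<notin> (A - {v}) <#> (A - {v})}"
  \<comment> \<open>The element \<open>v\<close> only contributes the quotient 1. Leaving it out
    saves one generator and makes the final inequality strict.\<close>
  define T where "T = (\<lambda>x. x \<otimes> inv v) ` (N - {v})"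
  have vc: "v \<in> carrier G" using A v by auto
  have N: "N \<subseteq> A" "finite N" using A by (auto simp: N_def)
  \<comment> \<open>If v v = y z with z < v, then y > v, against the choice of
    \<open>v\<close>.\<close>
  have "v \<in> N"
  proof (rule ccontr)
    assume "v \<notin> N"
    then obtain y z where yz: "y \<in> A" "y \<noteq> v" "z \<in> A" "z \<noteq> v" "v \<otimes> v = y \<otimes> z"
      using v by (auto simp: N_def set_mult_def)
    then have "(v, y) \<in> r" "v \<noteq> y" using less_of_mult_eq[of v v y z] v A by auto
    then show False using order_antisym v yz by blast
  qed
  have TQ: "T \<subseteq> quotient_group G A"
    using N v by (auto simp: T_def intro!: mult_inv_in_quotient_group)
  then have Tc: "T \<subseteq> carrier G"
    using subgroup.subset[OF subgroup_quotient_group[OF A(1)]] by auto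
  have gT: "x \<otimes> inv v \<in> generate G T" if "x \<in> N" for x
    using that vc generate.one[of G T] by (cases "x = v") (auto simp: T_def intro: generate.incl)
  have "generate G T = quotient_group G A"
    by (rule generate_eq_quotient_group[OF A(1) v(1) TQ],
        rule quotients_from_new_products[OF A v generate_is_subgroup[OF Tc]])
       (use gT in \<open>auto simp: N_def\<close>)
  moreover have "finite T" using N by (simp add: T_def)
  ultimately have "n \<le> card T"
    using ngen Tc unfolding generated_by_fewer_def by (meson not_less)
  also have "\<dots> \<le> card (N - {v})" unfolding T_def by (rule card_image_le) (use N in auto)
  also have "\<dots> < card N" using \<open>v \<in> N\<close> N by (intro psubset_card_mono) auto
  finally show ?thesis by (simp add: N_def)
qed

lemma card_set_mult_remove:
  assumes A: "A \<subseteq> carrier G" "finite A" and v: "v \<in> A"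
  shows "card ((A - {v}) <#> (A - {v})) + card {x \<in> A. v \<otimes> x \<notin> (A - {v}) <#> (A - {v})}
           \<le> card (A <#> A)"
proof -
  let ?B = "(A - {v}) <#> (A - {v})"
  let ?N = "{x \<in> A. v \<otimes> x \<notin> ?B}"
  have fin: "finite ?B" "finite (A <#> A)" using A by (auto intro: finite_set_mult)
  have "inj_on ((\<otimes>) v) ?N" using A v by (auto simp: inj_on_def subset_iff)
  then have "card ?B + card ?N = card ?B + card ((\<otimes>) v ` ?N)" by (simp add: card_image)
  also have "\<dots> = card (?B \<union> (\<otimes>) v ` ?N)"
    using A fin by (intro card_Un_disjoint[symmetric]) auto
  also have "\<dots> \<le> card (A <#> A)"
    using fin(2) v by (intro card_mono) (auto simp: set_mult_def)
  finally show ?thesis .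
qed

text \<open>Suppose v x = y z is an old product. Then v / y = z / x is a quotient of elements of
  \<open>A - {v}\<close>, so adding \<open>v\<close> would not enlarge the quotient group.\<close>

lemma new_products_of_smaller_quotient_group:
  assumes A: "A \<subseteq> carrier G" and v: "v \<in> A" "\<And>x. x \<in> A \<Longrightarrow> (x, v) \<in> r"
    and ne: "quotient_group G (A - {v}) \<noteq> quotient_group G A"
  shows "{x \<in> A. v \<otimes> x \<notin> (A - {v}) <#> (A - {v})} = A"
proof (rule ccontr)
  let ?Q = "quotient_group G (A - {v})"
  assume "\<not> ?thesis"
  then obtain x y z where xyz: "x \<in> A" "y \<in> A" "y \<noteq> v" "z \<in> A" "z \<noteq> v" "v \<otimes> x = y \<otimes> z"
    by (auto simp: set_mult_def)
  have c: "v \<in> carrier G" "x \<in> carrier G" "y \<in> carrier G" "z \<in> carrier G"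
    using A v xyz by auto
  have Q: "subgroup ?Q G" by (rule subgroup_quotient_group) (use A in auto)
  \<comment> \<open>The product v v is never old; this keeps x in \<open>A - {v}\<close>, so that z
    / x lies in \<open>?Q\<close>.\<close>
  have "x \<noteq> v"
    using less_of_mult_eq[OF c xyz(6)] v(2) xyz order_antisym by blast
  have "v \<otimes> inv y = (v \<otimes> inv y) \<otimes> (x \<otimes> inv x)" using c by simp
  also have "\<dots> = (v \<otimes> x) \<otimes> (inv x \<otimes> inv y)" by (simp only: c m_ac m_closed inv_closed)
  also have "\<dots> = (z \<otimes> inv x) \<otimes> (y \<otimes> inv y)"
    unfolding xyz(6) by (simp only: c m_ac m_closed inv_closed)
  also have "\<dots> = z \<otimes> inv x" using c by simp
  finally have vy: "v \<otimes> inv y \<in> ?Q"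
    using mult_inv_in_quotient_group[of z "A - {v}" x] xyz \<open>x \<noteq> v\<close> by simp
  \<comment> \<open>The base point is now y, which lies in \<open>A - {v}\<close>.\<close>
  have "quotient_group G A \<subseteq> ?Q"
    by (rule quotient_group_subset[OF Q A c(3)])
       (use vy xyz in \<open>auto intro: mult_inv_in_quotient_group\<close>)
  then show False using ne quotient_group_mono[of "A - {v}" A] A by auto
qed

text \<open>With base point a in \<open>A - {v}\<close>, the only quotient that can be missing is v
  / a, which becomes the additional generator.\<close>

lemma generated_by_fewer_insert:
  assumes A: "A \<subseteq> carrier G" and v: "v \<in> A" and ne: "A - {v} \<noteq> {}"
    and gen: "generated_by_fewer G n (quotient_group G (A - {v}))"
  shows "generated_by_fewer G (Suc n) (quotient_group G A)"
proof -
  obtain T where T: "T \<subseteq> carrier G" "finite T" "card T < n"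
    "generate G T = quotient_group G (A - {v})"
    using gen by (auto simp: generated_by_fewer_def)
  obtain a where a: "a \<in> A" "a \<noteq> v" using ne by auto
  let ?T = "insert (v \<otimes> inv a) T"
  have c: "a \<in> carrier G" "v \<in> carrier G" using A a v by auto
  have "T \<subseteq> quotient_group G A"
    using T(4) quotient_group_mono[of "A - {v}" A] A by (auto intro: generate.incl)
  then have TQ: "?T \<subseteq> quotient_group G A" using a v by (auto intro: mult_inv_in_quotient_group)
  have "quotient_group G (A - {v}) \<subseteq> generate G ?T"
    using T c mono_generate[of T ?T] by auto
  then have "x \<otimes> inv a \<in> generate G ?T" if "x \<in> A" for x
    using that a mult_inv_in_quotient_group[of x "A - {v}" a]
    by (cases "x = v") (auto intro: generate.incl)
  then have "generate G ?T = quotient_group G A"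
    by (rule generate_eq_quotient_group[OF A a(1) TQ])
  moreover have "card ?T < Suc n" using card_insert_le_m1[of "Suc (card T)" T] T
    by (simp add: card_insert_if)
  ultimately show ?thesis
    using T c unfolding generated_by_fewer_def by (intro exI[of _ ?T]) auto
qed

text \<open>The inequality is doubled to stay in the natural numbers. The induction keeps
  \<open>n\<close> arbitrary because removing the greatest element may lower it by one.\<close>

lemma freiman:
  assumes "A \<subseteq> carrier G" "finite A" "A \<noteq> {}"
    and "\<not> generated_by_fewer G n (quotient_group G A)"
  shows "2 * (n + 1) * card A \<le> 2 * card (A <#> A) + n * (n + 1)"
  using assms
proof (induction "card A" arbitrary: A n)
  case 0
  then show ?case by simp
next
  case (Suc k)
  note A = Suc.prems(1,2)
  obtain v where v: "v \<in> A" "\<And>x. x \<in> A \<Longrightarrow> (x, v) \<in> r"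
    using linear_order_on_greatest[OF order Suc.prems(2,3,1)] by blast
  define B where "B = A - {v}"
  define N where "N = {x \<in> A. v \<otimes> x \<notin> B <#> B}"
  have B: "B \<subseteq> carrier G" "finite B" "card B = k"
    using A v Suc.hyps(2) by (auto simp: B_def)
  have le: "card (B <#> B) + card N \<le> card (A <#> A)"
    using card_set_mult_remove[OF A v(1)] by (simp add: B_def N_def)
  have Nn: "n < card N"
    using card_new_products[OF A v Suc.prems(4)] by (simp add: B_def N_def)
  have cN: "card N \<le> Suc k" using A Suc.hyps(2) by (auto simp: N_def intro!: card_mono)
  show ?case
  proof (cases "B = {}")
    case True
    then have "k = 0" using B by simp
    \<comment> \<open>For a singleton, n < \<open>card N\<close> \<le> 1.\<close>
    then have "n = 0" "card A = 1" using Nn cN Suc.hyps(2) by auto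
    then show ?thesis using Nn le by simp
  next
    case ne: False
    show ?thesis
    proof (cases "generated_by_fewer G n (quotient_group G B)")
      case False
      \<comment> \<open>The same \<open>n\<close> still works for \<open>B\<close>, and the n + 1
        new products supply the increase of the bound from k to k + 1 elements.\<close>
      then have "2 * (n + 1) * k \<le> 2 * card (B <#> B) + n * (n + 1)"
        using Suc.hyps(1)[of B n] B ne by simp
      then show ?thesis using le Nn Suc.hyps(2)[symmetric] by simp
    next
      case True
      then obtain m where n: "n = Suc m" by (cases n) (auto simp: generated_by_fewer_def)
      have "quotient_group G B \<noteq> quotient_group G A" using True Suc.prems(4) by auto
      then have "N = A"
        using new_products_of_smaller_quotient_group[OF A(1) v] by (simp add: B_def N_def)
      moreover have "\<not> generated_by_fewer G m (quotient_group G B)"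
        using generated_by_fewer_insert[OF A(1) v(1)] ne Suc.prems(4) n by (auto simp: B_def)
      \<comment> \<open>Adding twice the k + 1 new products to this bound for \<open>m\<close> gives
        exactly the required bound for m + 1.\<close>
      then have "2 * (m + 1) * k \<le> 2 * card (B <#> B) + m * (m + 1)"
        using Suc.hyps(1)[of B m] B ne by simp
      ultimately show ?thesis using le n Suc.hyps(2)[symmetric] by (simp add: algebra_simps)
    qed
  qed
qed

end

section \<open>From ordered abelian groups to orderable groups\<close>

theorem theorem2p3:
  fixes G :: "('a, 'b) monoid_scheme" and S :: "'a set" and c :: nat
  assumes "c \<ge> 2"
    and "orderable_group G"
    and "S \<subseteq> carrier G" and "finite S"
    and "comm_group (G\<lparr>carrier := generate G S\<rparr>)"
    and "real (card (S <#>\<^bsub>G\<^esub> S)) < (real c + 1) * real (card S) - real c * (real c + 1) / 2"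
  shows "\<exists>T. T \<subseteq> carrier G \<and> finite T \<and> card T \<le> c \<and> generate G T = generate G S"
proof -
  interpret G: group G using assms(2) by (simp add: orderable_group_def)
  let ?H = "G\<lparr>carrier := generate G S\<rparr>"
  have sub: "subgroup (generate G S) G" by (rule G.generate_is_subgroup[OF assms(3)])
  have HG: "generate G S \<subseteq> carrier G" by (rule subgroup.subset[OF sub])
  obtain r where r: "linear_order_on (carrier G) r"
    and mono: "\<And>a b x y. \<lbrakk>a \<in> carrier G; b \<in> carrier G; x \<in> carrier G; y \<in> carrier G; (a, b) \<in> r\<rbrakk>
                 \<Longrightarrow> (x \<otimes>\<^bsub>G\<^esub> a \<otimes>\<^bsub>G\<^esub> y, x \<otimes>\<^bsub>G\<^esub> b \<otimes>\<^bsub>G\<^esub> y) \<in> r"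
    using assms(2) unfolding orderable_group_def by blast
  \<comment> \<open>Only the subgroup generated by \<open>S\<close> is abelian, so the order is
    restricted to it and the argument runs inside \<open>?H\<close>.\<close>
  define r' where "r' = r \<inter> generate G S \<times> generate G S"
  have "linear_order_on (generate G S) r'"
    using r HG unfolding r'_def order_on_defs refl_on_def total_on_def trans_def antisym_def
    by blast
  moreover have "(a \<otimes>\<^bsub>G\<^esub> x, b \<otimes>\<^bsub>G\<^esub> x) \<in> r'"
    if "(a, b) \<in> r'" "x \<in> generate G S" for a b x
    using mono[of a b "\<one>\<^bsub>G\<^esub>" x] that HG subgroup.m_closed[OF sub]
    by (auto simp: r'_def subset_iff)
  ultimately interpret H: ordered_comm_group ?H r'
    using assms(5) by (simp add: ordered_comm_group_def ordered_comm_group_axioms_def)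
  have SH: "S \<subseteq> carrier ?H" by (auto intro: generate.incl)
  \<comment> \<open>For empty \<open>S\<close> the assumed upper bound would be at most 0, but a
    cardinality cannot be below it.\<close>
  have ne: "S \<noteq> {}"
  proof
    assume "S = {}"
    moreover have "real c * (real c + 1) / 2 \<ge> 0" by simp
    moreover have "real (card (S <#>\<^bsub>G\<^esub> S)) < - (real c * (real c + 1) / 2)"
      using assms(6) \<open>S = {}\<close> by simp
    ultimately show False by linarith
  qed
  then obtain v where v: "v \<in> S" by auto
  have "2 * card (S <#>\<^bsub>G\<^esub> S) + c * (c + 1) < 2 * (c + 1) * card S"
  proof -
    have "real (2 * card (S <#>\<^bsub>G\<^esub> S) + c * (c + 1)) < real (2 * (c + 1) * card S)"
      using assms(6) by (simp add: field_simps)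
    then show ?thesis by linarith
  qed
  then have "generated_by_fewer ?H c (quotient_group ?H S)"
    using H.freiman[OF SH assms(4) ne, of c] by auto
  then obtain T where T: "T \<subseteq> carrier ?H" "finite T" "card T < c"
    "generate ?H T = quotient_group ?H S"
    by (auto simp: generated_by_fewer_def)
  \<comment> \<open>Fewer than \<open>c\<close> generators for the quotient group, together with
    \<open>v\<close>, make at most \<open>c\<close>.\<close>
  have "generate ?H (insert v T) = generate ?H S"
    by (rule H.generate_eq_insert_quotient_group[OF SH v T(1,4)])
  moreover have "insert v T \<subseteq> generate G S" using T SH v by auto
  \<comment> \<open>Generation inside the subgroup agrees with generation in
    \<open>G\<close>.\<close>
  ultimately have "generate G (insert v T) = generate G S"
    using G.generate_consistent[OF _ sub] SH by simp
  moreover have "card (insert v T) \<le> c" using T by (simp add: card_insert_if)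
  ultimately show ?thesis
    using T HG assms(3) v by (intro exI[of _ "insert v T"]) auto
qed

end
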